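(* Let $M\in\mathbb{R}^{n\times n}$ be symmetric positive definite. Consider iteration $k$ of the exact linesearch method (described in the context) applied to the minimization of $\frac12 x^THx+c^Tx$ with $H=H^T\succ0$, where $1\le k<r$. Assume that $p_i=\delta_i p_i^{PCG}$ with $\delta_i\ne 0$ for $i=0,\dots,k-1$, where $p_i^{PCG}$ are the search directions of the preconditioned method of conjugate gradients with preconditioning matrix $M$. Let $$A_k = I-\frac{1}{g_{k-1}^T p_{k-1}}\, p_{k-1} g_k^T .$$ Then $A_k$ is nonsingular with $$A_k^{-1} = I+\frac{1}{g_{k-1}^T p_{k-1}}\, p_{k-1} g_k^T,$$ and $MA_k p_k^{PCG}=-g_k$. In addition, if $p_k$ is given by $B_k p_k=-g_k$ with $B_k\in\mathbb{R}^{n\times n}$ nonsingular, then, for any nonzero scalar $\delta_k$, it holds that $p_k=\delta_k p_k^{PCG}$ if and only if $$B_k A_k^{-1}M^{-1} g_k=\frac1{\delta_k} g_k,$$ or equivalently if and only if $$B_k=A_k^T W_k A_k \quad\text{for some nonsingular } W_k \text{ with } W_kM^{-1} g_k=\frac1{\delta_k} g_k.$$ Finally, for $B_k=A_k^TW_kA_k$, it holds that $B_k\succ0$ if and only if $W_k\succ 0$.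
   Context: Let $H\in\mathbb{R}^{n\times n}$ with $H=H^T\succ0$ and $c\in\mathbb{R}^n$. For a square real matrix $X$, $X\succ0$ means $x^TXx>0$ for all $x\neq0$. Exact linesearch method: given $x_0\in\mathbb{R}^n$, set $g_0=Hx_0+c$; for $k=0,1,\dots$, as long as $g_k\ne0$, choose a search direction $p_k$ and set $$\theta_k=-\frac{g_k^Tp_k}{p_k^THp_k},\quad x_{k+1}=x_k+\theta_kp_k,\quad g_{k+1}=g_k+\theta_kHp_k .$$ The index $r$ denotes the iteration at which the method terminates, i.e. the first index with $g_r=0$; so $k<r$ means $g_0,\dots,g_k$ are all nonzero. The preconditioned method of conjugate gradients (PCG) with symmetric positive definite preconditioning matrix $M$ is the exact linesearch method with search directions $p_0^{PCG}=-M^{-1}g_0$ and $p_k^{PCG}=-M^{-1}g_k+\frac{g_k^TM^{-1}g_k}{g_{k-1}^TM^{-1}g_{k-1}}p_{k-1}^{PCG}$ for $k\ge1$. PCG and the method under consideration are started from the same $x_0$; when $p_i=\delta_ip_i^{PCG}$ with $\delta_i\neq0$ for $i=0,\dots,k-1$, the iterates $x_i$ and gradients $g_i$, $i=0,\dots,k$, of the two methods coincide. *)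

theory Defs
  imports "HOL-Analysis.Analysis"
begin

text \<open>Symmetry is deliberately not part of \<open>pos_def\<close>; it is a separate hypothesis where needed.\<close>

definition pos_def :: "real^'n^'n \<Rightarrow> bool" where
  "pos_def X \<longleftrightarrow> (\<forall>x. x \<noteq> 0 \<longrightarrow> x \<bullet> (X *v x) > 0)"

definition outer :: "real^'n \<Rightarrow> real^'n \<Rightarrow> real^'n^'n" where
  "outer u v = (\<chi> i j. u $ i * v $ j)"

text \<open>
  A run of the exact linesearch method on \<open>(1/2) x\<^sup>T H x + c\<^sup>T x\<close>, with iterates \<open>x\<close>, gradients \<open>g\<close>
  and search directions \<open>p\<close>. The values of the sequences are constrained only until the first
  zero gradient, where the method terminates.
\<close>

definition exact_linesearch ::
  "real^'n^'n \<Rightarrow> real^'n \<Rightarrow> (nat \<Rightarrow> real^'n) \<Rightarrow> (nat \<Rightarrow> real^'n) \<Rightarrow> (nat \<Rightarrow> real^'n) \<Rightarrow> bool" where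
  "exact_linesearch H c x g p \<longleftrightarrow>
     g 0 = H *v x 0 + c \<and>
     (\<forall>k. (\<forall>i\<le>k. g i \<noteq> 0) \<longrightarrow>
        (let \<theta> = - (g k \<bullet> p k) / (p k \<bullet> (H *v p k)) in
           x (Suc k) = x k + \<theta> *\<^sub>R p k \<and>
           g (Suc k) = g k + \<theta> *\<^sub>R (H *v p k)))"

definition pcg ::
  "real^'n^'n \<Rightarrow> real^'n^'n \<Rightarrow> real^'n \<Rightarrow>
     (nat \<Rightarrow> real^'n) \<Rightarrow> (nat \<Rightarrow> real^'n) \<Rightarrow> (nat \<Rightarrow> real^'n) \<Rightarrow> bool" where
  "pcg M H c x g p \<longleftrightarrow>
     exact_linesearch H c x g p \<and>
     (g 0 \<noteq> 0 \<longrightarrow> p 0 = - (matrix_inv M *v g 0)) \<and>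
     (\<forall>k. (\<forall>i\<le>Suc k. g i \<noteq> 0) \<longrightarrow>
        p (Suc k) = - (matrix_inv M *v g (Suc k))
          + ((g (Suc k) \<bullet> (matrix_inv M *v g (Suc k))) / (g k \<bullet> (matrix_inv M *v g k))) *\<^sub>R p k)"

end

theory Submission imports Defs begin

text \<open>
  The exact linesearch is unaffected by rescaling the search direction, so neither the gradients
  nor \<open>A\<^sub>k\<close> change when \<open>p\<^sub>i\<close> is replaced by the PCG direction. The orthogonality
  \<open>g\<^sub>k\<^sup>T p\<^sub>k\<^sub>-\<^sub>1 = 0\<close> then gives both \<open>A\<^sub>k\<^sup>-\<^sup>1\<close> and \<open>A\<^sub>k\<^sup>T g\<^sub>k = g\<^sub>k\<close>, while
  \<open>g\<^sub>i\<^sup>T p\<^sub>i = - g\<^sub>i\<^sup>T M\<^sup>-\<^sup>1 g\<^sub>i\<close> for PCG turns its recursion into \<open>A\<^sub>k p\<^sub>k = - M\<^sup>-\<^sup>1 g\<^sub>k\<close>.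
  Applying \<open>B\<^sub>k\<close> to \<open>p\<^sub>k = \<delta>\<^sub>k p\<^sub>k\<^sup>P\<^sup>C\<^sup>G\<close> yields the first criterion on \<open>B\<^sub>k\<close>; the second is the same
  equation for \<open>W\<^sub>k\<close>, because \<open>B \<mapsto> A\<^sup>-\<^sup>T B A\<^sup>-\<^sup>1\<close> inverts the congruence \<open>W \<mapsto> A\<^sup>T W A\<close>.
\<close>

lemma matrix_inv_right_left:
  fixes A :: "'a::semiring_1^'n^'m"
  assumes "invertible A"
  shows matrix_inv_right: "A ** matrix_inv A = mat 1"
    and matrix_inv_left: "matrix_inv A ** A = mat 1"
  using someI_ex[OF assms[unfolded invertible_def]] by (simp_all add: matrix_inv_def)

lemma matrix_inv_unique:
  fixes A :: "'a::semiring_1^'n^'m"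
  assumes "A ** B = mat 1" and "B ** A = mat 1"
  shows "matrix_inv A = B"
proof -
  have "invertible A"
    using assms by (auto simp: invertible_def)
  then have "matrix_inv A = matrix_inv A ** (A ** B)"
    by (simp add: assms)
  also have "\<dots> = B"
    using \<open>invertible A\<close> by (simp add: matrix_mul_assoc matrix_inv_left)
  finally show ?thesis .
qed

lemma invertible_matrix_inv:
  fixes A :: "'a::semiring_1^'n^'m"
  assumes "invertible A"
  shows "invertible (matrix_inv A)"
  using matrix_inv_right_left[OF assms] by (auto simp: invertible_def)

lemma matrix_inv_mult_vec_eq_iff:
  fixes A :: "'a::semiring_1^'n^'m"
  assumes "invertible A"
  shows "matrix_inv A *v y = x \<longleftrightarrow> y = A *v x"
  using matrix_inv_right_left[OF assms]
  by (metis matrix_vector_mul_assoc matrix_vector_mul_lid)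

lemma vector_matrix_mult_cancel:
  fixes A :: "'a::semiring_1^'n^'m"
  assumes "invertible A"
  shows "x v* A = y v* A \<longleftrightarrow> x = y"
  using matrix_inv_right[OF assms] by (metis vector_matrix_mul_assoc vector_matrix_mul_rid)

lemma matrix_vector_mult_minus_right:
  fixes A :: "'a::ring_1^'n^'m"
  shows "A *v (- x) = - (A *v x)"
  by (simp add: vec_eq_iff matrix_vector_mult_def sum_negf)

lemma matrix_vector_solution_eq_scaleR_iff:
  fixes B :: "real^'n^'m"
  assumes "invertible B" and "B *v p = b" and "d \<noteq> 0"
  shows "p = d *\<^sub>R q \<longleftrightarrow> B *v q = (1 / d) *\<^sub>R b"
proof -
  have "p = d *\<^sub>R q \<longleftrightarrow> q = (1 / d) *\<^sub>R p"
    using \<open>d \<noteq> 0\<close> by auto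
  also have "\<dots> \<longleftrightarrow> B *v q = B *v ((1 / d) *\<^sub>R p)"
    using inj_matrix_vector_mult[OF \<open>invertible B\<close>] by (auto dest: injD)
  also have "\<dots> \<longleftrightarrow> B *v q = (1 / d) *\<^sub>R b"
    by (simp add: matrix_vector_mult_scaleR \<open>B *v p = b\<close>)
  finally show ?thesis .
qed

lemma matrix_vector_solutions_scaleR_iff:
  fixes A B :: "real^'n^'n"
  assumes "invertible A" and "A *v q = - z" and "invertible B" and "B *v p = - g" and "d \<noteq> 0"
  shows "p = d *\<^sub>R q \<longleftrightarrow> B *v (matrix_inv A *v z) = (1 / d) *\<^sub>R g"
proof -
  have "matrix_inv A *v z = - q"
    by (simp add: matrix_inv_mult_vec_eq_iff[OF \<open>invertible A\<close>] assms(2)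
        matrix_vector_mult_minus_right)
  moreover have "B *v (- p) = g"
    by (simp add: matrix_vector_mult_minus_right assms(4))
  ultimately show ?thesis
    using matrix_vector_solution_eq_scaleR_iff[of B "- p" g d "- q"] assms(3,5) by simp
qed

lemma congruence_compose:
  fixes A :: "'a::comm_semiring_1^'n^'m"
  shows "transpose C ** (transpose A ** W ** A) ** C = transpose (A ** C) ** W ** (A ** C)"
  by (simp add: matrix_transpose_mul matrix_mul_assoc)

lemma congruence_eq_iff:
  fixes A :: "'a::comm_semiring_1^'n^'m"
  assumes "invertible A"
  shows "B = transpose A ** W ** A \<longleftrightarrow> W = transpose (matrix_inv A) ** B ** matrix_inv A"
  using matrix_inv_right_left[OF assms] by (auto simp: congruence_compose)

lemma ex_congruence_mapping_iff:
  fixes A B :: "real^'n^'n"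
  assumes "invertible A" and "invertible B"
  shows "(\<exists>W. invertible W \<and> B = transpose A ** W ** A \<and> W *v u = w)
    \<longleftrightarrow> B *v (matrix_inv A *v u) = w v* A"
proof -
  define W where "W = transpose (matrix_inv A) ** B ** matrix_inv A"
  have invertible_W: "invertible W"
    unfolding W_def using assms
    by (intro invertible_mult transpose_invertible invertible_matrix_inv)
  have B_eq: "B = transpose A ** W ** A"
    by (simp add: congruence_eq_iff[OF \<open>invertible A\<close>] W_def)
  have "A *v (matrix_inv A *v u) = u"
    using matrix_inv_mult_vec_eq_iff[OF \<open>invertible A\<close>] by metis
  then have "B *v (matrix_inv A *v u) = (W *v u) v* A"
    unfolding B_eq by (simp flip: matrix_vector_mul_assoc)
  then have "W *v u = w \<longleftrightarrow> B *v (matrix_inv A *v u) = w v* A"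
    by (simp add: vector_matrix_mult_cancel[OF \<open>invertible A\<close>])
  moreover have "B = transpose A ** V ** A \<longleftrightarrow> V = W" for V
    by (simp add: congruence_eq_iff[OF \<open>invertible A\<close>] W_def)
  ultimately show ?thesis
    using invertible_W by auto
qed

lemma pos_def_imp_invertible:
  assumes "pos_def M"
  shows "invertible M"
proof -
  have "x = 0" if "M *v x = 0" for x
    using assms that by (force simp: pos_def_def)
  then show ?thesis
    by (simp add: invertible_left_inverse matrix_left_invertible_ker)
qed

lemma pos_def_congruence:
  fixes A :: "real^'n^'m"
  assumes "inj ((*v) A)" and "pos_def W"
  shows "pos_def (transpose A ** W ** A)"
  unfolding pos_def_def
proof (intro allI impI)
  fix x :: "real^'n"
  assume "x \<noteq> 0"
  then have "A *v x \<noteq> 0"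
    using injD[OF assms(1), of x 0] by auto
  then have "0 < (A *v x) \<bullet> (W *v (A *v x))"
    using assms(2) by (simp add: pos_def_def)
  also have "\<dots> = x \<bullet> ((transpose A ** W ** A) *v x)"
    by (simp add: dot_lmul_matrix inner_commute[of x] inner_commute[of "A *v x"]
        flip: matrix_vector_mul_assoc)
  finally show "0 < x \<bullet> ((transpose A ** W ** A) *v x)" .
qed

lemma pos_def_congruence_iff:
  fixes A :: "real^'n^'m"
  assumes "invertible A"
  shows "pos_def (transpose A ** W ** A) \<longleftrightarrow> pos_def W"
proof
  assume "pos_def (transpose A ** W ** A)"
  moreover have "W = transpose (matrix_inv A) ** (transpose A ** W ** A) ** matrix_inv A"
    using congruence_eq_iff[OF assms] by blast
  ultimately show "pos_def W"
    using pos_def_congruence inj_matrix_vector_mult invertible_matrix_inv assms by metis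
next
  assume "pos_def W"
  then show "pos_def (transpose A ** W ** A)"
    by (intro pos_def_congruence inj_matrix_vector_mult assms)
qed

lemma outer_mult_vec: "outer u v *v w = (v \<bullet> w) *\<^sub>R u"
  by (simp add: vec_eq_iff outer_def matrix_vector_mult_def inner_vec_def
      sum_distrib_left sum_distrib_right mult_ac)

lemma vec_mult_outer: "w v* outer u v = (w \<bullet> u) *\<^sub>R v"
  by (simp add: vec_eq_iff outer_def vector_matrix_mult_def inner_vec_def
      sum_distrib_left sum_distrib_right mult_ac)

lemma outer_scaleR_left: "outer (d *\<^sub>R u) v = d *\<^sub>R outer u v"
  by (simp add: vec_eq_iff outer_def)

lemma id_plus_outer_mult_vec:
  "(mat 1 + t *\<^sub>R outer u v) *v w = w + (t * (v \<bullet> w)) *\<^sub>R u"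
  by (simp add: matrix_vector_mult_add_rdistrib outer_mult_vec flip: scaleR_matrix_vector_assoc)

lemma id_minus_outer_mult_vec:
  "(mat 1 - t *\<^sub>R outer u v) *v w = w - (t * (v \<bullet> w)) *\<^sub>R u"
  using id_plus_outer_mult_vec[of "- t"] by simp

lemma
  fixes u v :: "real^'n"
  assumes "t * (v \<bullet> u) \<noteq> 1"
  shows invertible_id_minus_outer: "invertible (mat 1 - t *\<^sub>R outer u v)" (is "invertible ?A")
    and matrix_inv_id_minus_outer:
      "matrix_inv (mat 1 - t *\<^sub>R outer u v) = mat 1 + (t / (1 - t * (v \<bullet> u))) *\<^sub>R outer u v"
proof -
  define s where "s = t / (1 - t * (v \<bullet> u))"
  define B where "B = mat 1 + s *\<^sub>R outer u v"
  have coefficient_eq_0: "s - t - t * s * (v \<bullet> u) = 0"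
    using assms by (simp add: s_def field_simps)
  have "?A *v (B *v w) = w + ((s - t - t * s * (v \<bullet> u)) * (v \<bullet> w)) *\<^sub>R u" for w
    unfolding B_def id_plus_outer_mult_vec id_minus_outer_mult_vec
    by (simp add: inner_add_right algebra_simps)
  then have "?A *v (B *v w) = w" for w
    by (simp add: coefficient_eq_0)
  then have right_inverse: "?A ** B = mat 1"
    by (simp add: matrix_eq flip: matrix_vector_mul_assoc)
  then show "invertible ?A"
    unfolding invertible_right_inverse by blast
  have "matrix_inv ?A = B"
    using right_inverse right_inverse[unfolded matrix_left_right_inverse] by (rule matrix_inv_unique)
  then show "matrix_inv ?A = mat 1 + (t / (1 - t * (v \<bullet> u))) *\<^sub>R outer u v"
    by (simp add: B_def s_def)
qed

text \<open>The matrix \<open>A\<^sub>k\<close> is \<open>pcg_factor g\<^sub>k\<^sub>-\<^sub>1 p\<^sub>k\<^sub>-\<^sub>1 g\<^sub>k\<close>.\<close>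

definition pcg_factor :: "real^'n \<Rightarrow> real^'n \<Rightarrow> real^'n \<Rightarrow> real^'n^'n" where
  "pcg_factor g p g' = mat 1 - (1 / (g \<bullet> p)) *\<^sub>R outer p g'"

lemma pcg_factor_scaleR:
  assumes "d \<noteq> 0"
  shows "pcg_factor g (d *\<^sub>R p) g' = pcg_factor g p g'"
  using assms by (simp add: pcg_factor_def outer_scaleR_left)

lemma
  assumes "g' \<bullet> p = 0"
  shows invertible_pcg_factor: "invertible (pcg_factor g p g')"
    and matrix_inv_pcg_factor:
      "matrix_inv (pcg_factor g p g') = mat 1 + (1 / (g \<bullet> p)) *\<^sub>R outer p g'"
  unfolding pcg_factor_def
  using invertible_id_minus_outer[of _ g' p] matrix_inv_id_minus_outer[of _ g' p] assms by simp_all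

lemma pcg_factor_mult_vec:
  "pcg_factor g p g' *v w = w - ((g' \<bullet> w) / (g \<bullet> p)) *\<^sub>R p"
  by (simp add: pcg_factor_def id_minus_outer_mult_vec)

lemma vec_mult_pcg_factor:
  "w v* pcg_factor g p g' = w - ((w \<bullet> p) / (g \<bullet> p)) *\<^sub>R g'"
  by (simp add: pcg_factor_def vector_matrix_mult_diff_rdistrib vec_mult_outer
      vector_scaleR_matrix_ac)

lemma ex_congruence_pcg_factor_iff:
  fixes B :: "real^'n^'n" and g :: "real^'n"
  assumes "g' \<bullet> p = 0" and "invertible B"
  defines "A \<equiv> pcg_factor g p g'"
  shows "(\<exists>W. invertible W \<and> B = transpose A ** W ** A \<and> W *v u = e *\<^sub>R g')
    \<longleftrightarrow> B *v (matrix_inv A *v u) = e *\<^sub>R g'"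
proof -
  have "(e *\<^sub>R g') v* A = e *\<^sub>R g'"
    by (simp add: A_def vec_mult_pcg_factor \<open>g' \<bullet> p = 0\<close>)
  moreover have "invertible A"
    unfolding A_def using \<open>g' \<bullet> p = 0\<close> by (rule invertible_pcg_factor)
  ultimately show ?thesis
    by (simp add: ex_congruence_mapping_iff \<open>invertible B\<close>)
qed

lemma exact_linesearch_gradient_Suc:
  assumes "exact_linesearch H c x g p" and "\<forall>i\<le>k. g i \<noteq> 0"
  shows "g (Suc k) = g k - ((g k \<bullet> p k) / (p k \<bullet> (H *v p k))) *\<^sub>R (H *v p k)"
  using assms by (simp add: exact_linesearch_def Let_def)

lemma exact_linesearch_orthogonal:
  assumes "pos_def H" and "exact_linesearch H c x g p" and "\<forall>i\<le>k. g i \<noteq> 0"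
  shows "g (Suc k) \<bullet> p k = 0"
proof (cases "p k = 0")
  case False
  with assms(1) have "p k \<bullet> (H *v p k) \<noteq> 0"
    by (force simp: pos_def_def)
  then show ?thesis
    by (simp add: exact_linesearch_gradient_Suc[OF assms(2,3)] inner_diff_left inner_commute[of "H *v p k"])
qed simp

lemma exact_step_scaleR:
  fixes H :: "real^'n^'n"
  assumes "d \<noteq> 0"
  shows "((g \<bullet> (d *\<^sub>R p)) / ((d *\<^sub>R p) \<bullet> (H *v (d *\<^sub>R p)))) *\<^sub>R (H *v (d *\<^sub>R p))
    = ((g \<bullet> p) / (p \<bullet> (H *v p))) *\<^sub>R (H *v p)"
  using assms by (simp add: matrix_vector_mult_scaleR)

lemma exact_linesearch_gradients_eq:
  assumes run: "exact_linesearch H c x g p" and run': "exact_linesearch H c x' g' p'"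
    and start: "x' 0 = x 0"
    and parallel: "\<forall>i<k. \<delta> i \<noteq> 0 \<and> p i = \<delta> i *\<^sub>R p' i"
    and nonzero: "\<forall>i<k. g i \<noteq> 0" and "j \<le> k"
  shows "g' j = g j"
  using parallel nonzero \<open>j \<le> k\<close>
proof (induction k arbitrary: j)
  case 0
  with run run' start show ?case
    by (simp add: exact_linesearch_def)
next
  case (Suc m)
  have gradients_eq: "g' i = g i" if "i \<le> m" for i
    using Suc that by simp
  have nonzero: "\<forall>i\<le>m. g i \<noteq> 0"
    using Suc.prems(2) by simp
  then have nonzero': "\<forall>i\<le>m. g' i \<noteq> 0"
    using gradients_eq by simp
  have "\<delta> m \<noteq> 0" and "p m = \<delta> m *\<^sub>R p' m"
    using Suc.prems(1) by auto
  have "g' (Suc m) = g (Suc m)"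
    by (simp only: exact_linesearch_gradient_Suc[OF run nonzero]
        exact_linesearch_gradient_Suc[OF run' nonzero']
        gradients_eq[OF order.refl] \<open>p m = \<delta> m *\<^sub>R p' m\<close>
        exact_step_scaleR[OF \<open>\<delta> m \<noteq> 0\<close>])
  with gradients_eq \<open>j \<le> Suc m\<close> show ?case
    by (auto simp: le_Suc_eq)
qed

lemma pcg_imp_exact_linesearch: "pcg M H c x g p \<Longrightarrow> exact_linesearch H c x g p"
  by (simp add: pcg_def)

lemma pcg_direction_Suc:
  assumes "pcg M H c x g p" and "\<forall>i\<le>Suc k. g i \<noteq> 0"
  shows "p (Suc k) = - (matrix_inv M *v g (Suc k))
    + ((g (Suc k) \<bullet> (matrix_inv M *v g (Suc k))) / (g k \<bullet> (matrix_inv M *v g k))) *\<^sub>R p k"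
  using assms by (simp add: pcg_def)

lemma pcg_gradient_inner_direction:
  assumes "pos_def H" and pcg: "pcg M H c x g p" and nonzero: "\<forall>i\<le>k. g i \<noteq> 0"
  shows "g k \<bullet> p k = - (g k \<bullet> (matrix_inv M *v g k))"
proof (cases k)
  case 0
  with pcg nonzero show ?thesis
    by (simp add: pcg_def)
next
  case (Suc m)
  have "g (Suc m) \<bullet> p m = 0"
    using assms Suc by (intro exact_linesearch_orthogonal pcg_imp_exact_linesearch) auto
  then show ?thesis
    unfolding Suc pcg_direction_Suc[OF pcg nonzero[unfolded Suc]]
    by (simp add: inner_diff_right)
qed

lemma pcg_factor_mult_pcg_direction:
  assumes "pos_def H" and pcg: "pcg M H c x g p" and nonzero: "\<forall>i\<le>Suc k. g i \<noteq> 0"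
  shows "pcg_factor (g k) (p k) (g (Suc k)) *v p (Suc k) = - (matrix_inv M *v g (Suc k))"
proof -
  have "g i \<bullet> p i = - (g i \<bullet> (matrix_inv M *v g i))" if "i \<le> Suc k" for i
    using assms that by (intro pcg_gradient_inner_direction) auto
  then have "pcg_factor (g k) (p k) (g (Suc k)) *v p (Suc k) = p (Suc k)
      - ((g (Suc k) \<bullet> (matrix_inv M *v g (Suc k))) / (g k \<bullet> (matrix_inv M *v g k))) *\<^sub>R p k"
    by (simp add: pcg_factor_mult_vec)
  also have "\<dots> = - (matrix_inv M *v g (Suc k))"
    by (simp add: pcg_direction_Suc[OF pcg nonzero])
  finally show ?thesis .
qed

lemma pcg_factor_mult_parallel_pcg_direction:
  assumes "pos_def H" and run: "exact_linesearch H c x g p" and pcg: "pcg M H c x' g' p'"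
    and start: "x' 0 = x 0"
    and parallel: "\<forall>i<Suc k. \<delta> i \<noteq> 0 \<and> p i = \<delta> i *\<^sub>R p' i"
    and nonzero: "\<forall>i\<le>Suc k. g i \<noteq> 0"
  shows "pcg_factor (g k) (p k) (g (Suc k)) *v p' (Suc k) = - (matrix_inv M *v g (Suc k))"
proof -
  have gradients_eq: "g' i = g i" if "i \<le> Suc k" for i
    using exact_linesearch_gradients_eq[OF run pcg_imp_exact_linesearch[OF pcg] start] that
      parallel nonzero less_Suc_eq_le less_imp_le by metis
  have "pcg_factor (g k) (p k) (g (Suc k)) = pcg_factor (g' k) (p' k) (g' (Suc k))"
    using parallel by (simp add: gradients_eq pcg_factor_scaleR)
  then show ?thesis
    using pcg_factor_mult_pcg_direction[OF \<open>pos_def H\<close> pcg, of k] nonzero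
    by (simp add: gradients_eq)
qed

theorem proposition6p1:
  fixes H M A :: "real^'n^'n" and c :: "real^'n"
    and x g p xPCG gPCG pPCG :: "nat \<Rightarrow> real^'n"
    and \<delta> :: "nat \<Rightarrow> real" and k :: nat
  assumes H_sym: "transpose H = H" and H_pos: "pos_def H"
    and M_sym: "transpose M = M" and M_pos: "pos_def M"
    and run: "exact_linesearch H c x g p"
    and run_PCG: "pcg M H c xPCG gPCG pPCG"
    and same_start: "xPCG 0 = x 0"
    and k_ge_1: "1 \<le> k"
    and not_terminated: "\<forall>i\<le>k. g i \<noteq> 0"
    and parallel: "\<forall>i<k. \<delta> i \<noteq> 0 \<and> p i = \<delta> i *\<^sub>R pPCG i"
    and A_eq: "A = mat 1 - (1 / (g (k - 1) \<bullet> p (k - 1))) *\<^sub>R outer (p (k - 1)) (g k)"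
  shows "invertible A
    \<and> matrix_inv A = mat 1 + (1 / (g (k - 1) \<bullet> p (k - 1))) *\<^sub>R outer (p (k - 1)) (g k)
    \<and> (M ** A) *v pPCG k = - g k
    \<and> (\<forall>B :: real^'n^'n. invertible B \<and> B *v p k = - g k \<longrightarrow>
         (\<forall>d :: real. d \<noteq> 0 \<longrightarrow>
            (p k = d *\<^sub>R pPCG k \<longleftrightarrow>
               (B ** matrix_inv A ** matrix_inv M) *v g k = (1 / d) *\<^sub>R g k)
          \<and> (p k = d *\<^sub>R pPCG k \<longleftrightarrow>
               (\<exists>W :: real^'n^'n. invertible W \<and> B = transpose A ** W ** A
                  \<and> (W ** matrix_inv M) *v g k = (1 / d) *\<^sub>R g k))))
    \<and> (\<forall>B W :: real^'n^'n. B = transpose A ** W ** A \<longrightarrow> (pos_def B \<longleftrightarrow> pos_def W))"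
proof -
  obtain m where k_eq: "k = Suc m"
    using k_ge_1 by (cases k) auto
  have A_factor: "A = pcg_factor (g m) (p m) (g k)"
    by (simp add: A_eq k_eq pcg_factor_def)
  have orthogonal: "g k \<bullet> p m = 0"
    unfolding k_eq using not_terminated k_eq by (intro exact_linesearch_orthogonal[OF H_pos run]) simp
  have A_invertible: "invertible A"
    unfolding A_factor by (rule invertible_pcg_factor[OF orthogonal])
  have A_mult_pPCG: "A *v pPCG k = - (matrix_inv M *v g k)"
    using pcg_factor_mult_parallel_pcg_direction[OF H_pos run run_PCG same_start] parallel
      not_terminated unfolding A_factor k_eq by blast
  have "M *v (matrix_inv M *v g k) = g k"
    using matrix_inv_mult_vec_eq_iff[OF pos_def_imp_invertible[OF M_pos]] by metis
  then have MA_mult_pPCG: "(M ** A) *v pPCG k = - g k"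
    by (simp add: A_mult_pPCG matrix_vector_mult_minus_right flip: matrix_vector_mul_assoc)
  show ?thesis
    using A_invertible MA_mult_pPCG matrix_inv_pcg_factor[OF orthogonal, of "g m", folded A_factor]
      matrix_vector_solutions_scaleR_iff[OF A_invertible A_mult_pPCG]
      ex_congruence_pcg_factor_iff[OF orthogonal, of _ "g m", folded A_factor]
      pos_def_congruence_iff[OF A_invertible]
    by (simp add: k_eq flip: matrix_vector_mul_assoc)
qed

end
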